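(* Let $\mathcal{M}_\pi$ and $\mathcal{M}_\mu$ be two positroids on $[n]$ without loops or coloops, with associated (fixed-point-free) decorated permutations $\pi$ and $\mu$ respectively, such that $\operatorname{rk}(\mathcal{M}_\mu)<\operatorname{rk}(\mathcal{M}_\pi)$. If $\mathcal{M}_\pi$ and $\mathcal{M}_\mu$ are concordant, then every CCW-arrow of $\mu$ is covered by CCW-arrows of $\pi$.
   Context: A positroid of rank $d$ on $[n]=\{1,\dots,n\}$ is a matroid whose bases are the column sets of the nonzero maximal minors of some real $d\times n$ matrix of rank $d$ all of whose maximal minors are nonnegative. The cyclically shifted order $<_i$ on $[n]$ is $i<_i i+1<_i\cdots<_i n<_i 1<_i\cdots<_i i-1$. For $a,b\in[n]$ the cyclic interval is $[a,b]=\{x\in[n]: x\le_a b\}$ (nonempty; $[a,a-1]=[n]$, indices mod $n$). Decorated permutation of a loopless and coloopless positroid $\mathcal{M}$ with rank function $\operatorname{rk}$: it is the permutation $\pi$ of $[n]$ (without fixed points) for which $\pi(i)$ is the first element $j$ in the list $i+1,i+2,\dots,i-1$ (cyclically) such that $\operatorname{rk}(\{i,i+1,\dots,j\})=\operatorname{rk}(\{i+1,\dots,j\})$. A CCW-arrow of a permutation $\sigma$ is a cyclic interval of the form $[x,\sigma^{-1}(x)]$, $x\in[n]$. A set $S\subseteq[n]$ is covered by CCW-arrows of $\sigma$ if each element of $S$ is contained in some CCW-arrow of $\sigma$ that is itself contained in $S$. Two matroids on $[n]$ of different ranks $r<r'$ are concordant if they can be realized by the same matrix, i.e. there is a real $r'\times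 n$ matrix of rank $r'$ whose column matroid (bases = column sets of nonzero maximal minors) is the matroid of rank $r'$, and such that the submatrix formed by its first $r$ rows has rank $r$ and has the matroid of rank $r$ as its column matroid. *)

theory Defs
  imports
    "Jordan_Normal_Form.DL_Rank"
    "Jordan_Normal_Form.DL_Submatrix"
    "HOL-Combinatorics.Permutations"
begin

(* A matroid is represented by its ground set and its family of bases. *)

definition matroid :: "nat set \<Rightarrow> nat set set \<Rightarrow> bool" where
  "matroid E \<B> \<longleftrightarrow> finite E \<and> \<B> \<noteq> {} \<and> (\<forall>B\<in>\<B>. B \<subseteq> E) \<and>
     (\<forall>B\<in>\<B>. \<forall>B'\<in>\<B>. \<forall>x\<in>B - B'. \<exists>y\<in>B' - B. insert y (B - {x}) \<in> \<B>)"

definition rk :: "nat set set \<Rightarrow> nat set \<Rightarrow> nat" where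
  "rk \<B> S = Max ((\<lambda>B. card (B \<inter> S)) ` \<B>)"

definition loopless :: "nat set \<Rightarrow> nat set set \<Rightarrow> bool" where
  "loopless E \<B> \<longleftrightarrow> (\<forall>x\<in>E. \<exists>B\<in>\<B>. x \<in> B)"

definition coloopless :: "nat set \<Rightarrow> nat set set \<Rightarrow> bool" where
  "coloopless E \<B> \<longleftrightarrow> (\<forall>x\<in>E. \<exists>B\<in>\<B>. x \<notin> B)"

(* Matrix rows and columns are numbered from 0, whereas the ground set of a matroid is
   {1..n}: the element Suc j labels column j. *)

definition max_minor :: "real mat \<Rightarrow> nat set \<Rightarrow> real" where
  "max_minor A S = det (submatrix A UNIV {j. Suc j \<in> S})"

definition max_column_sets :: "real mat \<Rightarrow> nat set set" where
  "max_column_sets A = {S. S \<subseteq> {1..dim_col A} \<and> card S = dim_row A}"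

definition column_bases :: "real mat \<Rightarrow> nat set set" where
  "column_bases A = {S \<in> max_column_sets A. max_minor A S \<noteq> 0}"

definition full_row_rank :: "real mat \<Rightarrow> bool" where
  "full_row_rank A \<longleftrightarrow> vec_space.rank (dim_row A) A = dim_row A"

definition positroid :: "nat \<Rightarrow> nat set set \<Rightarrow> bool" where
  "positroid n \<B> \<longleftrightarrow> matroid {1..n} \<B> \<and>
     (\<exists>d. \<exists>A \<in> carrier_mat d n. full_row_rank A \<and>
        (\<forall>S \<in> max_column_sets A. max_minor A S \<ge> 0) \<and> \<B> = column_bases A)"

(* The position of x in the shifted order a, a+1, ..., n, 1, ..., a-1
   (for a and x in {1..n}), counted from 0. *)

definition cyc_pos :: "nat \<Rightarrow> nat \<Rightarrow> nat \<Rightarrow> nat" where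
  "cyc_pos n a x = (x + n - a) mod n"

definition cyc_interval :: "nat \<Rightarrow> nat \<Rightarrow> nat \<Rightarrow> nat set" where
  "cyc_interval n a b = {x \<in> {1..n}. cyc_pos n a x \<le> cyc_pos n a b}"

definition cyc_succ :: "nat \<Rightarrow> nat \<Rightarrow> nat" where
  "cyc_succ n i = (if i = n then 1 else Suc i)"

definition drop_at :: "nat \<Rightarrow> nat set set \<Rightarrow> nat \<Rightarrow> nat \<Rightarrow> bool" where
  "drop_at n \<B> i j \<longleftrightarrow>
     rk \<B> (cyc_interval n i j) = rk \<B> (cyc_interval n (cyc_succ n i) j)"

definition decorated_permutation :: "nat \<Rightarrow> nat set set \<Rightarrow> (nat \<Rightarrow> nat) \<Rightarrow> bool" where
  "decorated_permutation n \<B> \<pi> \<longleftrightarrow> \<pi> permutes {1..n} \<and>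
     (\<forall>i \<in> {1..n}. \<pi> i \<noteq> i \<and> drop_at n \<B> i (\<pi> i) \<and>
        (\<forall>j \<in> {1..n} - {i}. cyc_pos n i j < cyc_pos n i (\<pi> i) \<longrightarrow> \<not> drop_at n \<B> i j))"

definition ccw_arrows :: "nat \<Rightarrow> (nat \<Rightarrow> nat) \<Rightarrow> nat set set" where
  "ccw_arrows n \<sigma> = (\<lambda>x. cyc_interval n x (inv_into {1..n} \<sigma> x)) ` {1..n}"

definition covered_by_ccw_arrows :: "nat \<Rightarrow> (nat \<Rightarrow> nat) \<Rightarrow> nat set \<Rightarrow> bool" where
  "covered_by_ccw_arrows n \<sigma> S \<longleftrightarrow> (\<forall>s\<in>S. \<exists>I \<in> ccw_arrows n \<sigma>. s \<in> I \<and> I \<subseteq> S)"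

definition first_rows :: "nat \<Rightarrow> real mat \<Rightarrow> real mat" where
  "first_rows r A = submatrix A {..<r} UNIV"

definition concordant :: "nat \<Rightarrow> nat set set \<Rightarrow> nat set set \<Rightarrow> bool" where
  "concordant n \<L> \<H> \<longleftrightarrow>
     (let r = rk \<L> {1..n}; r' = rk \<H> {1..n} in
        r < r' \<and>
        (\<exists>A \<in> carrier_mat r' n. full_row_rank A \<and> column_bases A = \<H> \<and>
           full_row_rank (first_rows r A) \<and> column_bases (first_rows r A) = \<L>))"

end

theory Submission
  imports Defs "HOL-Library.Function_Algebras"
begin

text \<open>
  For a CCW-arrow \<open>[x, y]\<close> of a loopless positroid the complementary cyclic interval \<open>I\<close> is a
  flat. Otherwise some \<open>s\<close> strictly between \<open>x\<close> and \<open>y\<close> lies in the span of \<open>I\<close>, hence equals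
  \<open>\<alpha>\<close> times some \<open>i \<in> I\<close> modulo the other elements of a basis of \<open>I\<close>. Replacing \<open>i\<close> by
  \<open>s\<close> in a basis multiplies the maximal minor by \<open>\<alpha>\<close> and a sign that counts the basis elements
  between \<open>i\<close> and \<open>s\<close>. Two bases that differ only by exchanging \<open>x\<close> and \<open>y\<close> give
  opposite signs, because \<open>{x, y}\<close> and \<open>{s, i}\<close> cross.

  Linear dependencies survive the deletion of rows, so \<open>I\<close> is also a flat of the concordant
  positroid of larger rank. If no CCW-arrow of \<open>\<pi>\<close> within \<open>[x, y]\<close> contained \<open>s\<close>, then modulo
  \<open>I\<close> the spans of \<open>[x, s]\<close> and \<open>[s + 1, y]\<close> would be independent, while \<open>s\<close> is spanned by
  the latter, contradicting \<open>s \<notin> span I\<close>.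
\<close>

section \<open>Real sequences as vectors, and determinants of lists of columns\<close>

lemma sum_fun_apply: "(\<Sum>i\<in>S. f i) k = (\<Sum>i\<in>S. f i k)" for f :: "'a \<Rightarrow> nat \<Rightarrow> real"
  by (induction S rule: infinite_finite_induct) auto

text \<open>Sequences carry no dimension, so columns of matrices with different numbers of rows are
  vectors of one space.\<close>

interpretation fv: vector_space "\<lambda>(c::real) (f::nat \<Rightarrow> real) k. c * f k"
  by unfold_locales (auto simp: algebra_simps fun_eq_iff)

text \<open>With columns in a list, reordering and replacing them become list operations. Only the
  first \<open>length us\<close> entries of each column are read.\<close>

definition cdet :: "(nat \<Rightarrow> real) list \<Rightarrow> real" where
  "cdet us = det (mat (length us) (length us) (\<lambda>(i, j). (us ! j) i))"

text \<open>
  Both Laplace expansions along the column of \<open>v\<close> involve the same minors.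
\<close>
lemma cdet_move: "cdet (us @ v # ws) = (-1) ^ length ws * cdet (us @ ws @ [v])"
proof -
  define m where "m = length us"
  define n where "n = length us + length ws"
  define P where "P = mat (Suc n) (Suc n) (\<lambda>(i, j). ((us @ v # ws) ! j) i)"
  define Q where "Q = mat (Suc n) (Suc n) (\<lambda>(i, j). ((us @ ws @ [v]) ! j) i)"
  have del: "mat_delete P i m = mat_delete Q i n" if "i < Suc n" for i
    using that by (intro eq_matI) (auto simp: P_def Q_def mat_delete_def nth_append m_def n_def nth_Cons')
  have "cdet (us @ v # ws) = (\<Sum>i<Suc n. P $$ (i, m) * cofactor P i m)"
    using laplace_expansion_column[of P "Suc n" m] by (simp add: cdet_def P_def n_def m_def)
  also have "\<dots> = (\<Sum>i<Suc n. (-1) ^ length ws * (Q $$ (i, n) * cofactor Q i n))"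
  proof (intro sum.cong refl)
    fix i assume "i \<in> {..<Suc n}"
    then have "P $$ (i, m) = v i" "Q $$ (i, n) = v i"
      by (auto simp: P_def Q_def m_def n_def nth_append)
    moreover have "(-1::real) ^ (i + m) = (-1) ^ length ws * (-1) ^ (i + n)"
      by (simp add: m_def n_def power_add flip: power_mult_distrib)
    ultimately show "P $$ (i, m) * cofactor P i m = (-1) ^ length ws * (Q $$ (i, n) * cofactor Q i n)"
      using del[of i] \<open>i \<in> {..<Suc n}\<close> by (simp add: cofactor_def)
  qed
  also have "\<dots> = (-1) ^ length ws * cdet (us @ ws @ [v])"
    using laplace_expansion_column[of Q "Suc n" n]
    by (simp add: cdet_def Q_def n_def sum_distrib_left del: sum.lessThan_Suc)
  finally show ?thesis .
qed

text \<open>The cofactors along the last column do not involve \<open>v\<close>. This is the source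
  of linearity in that column.\<close>

lemma cdet_snoc_expand: "\<exists>c. \<forall>v. cdet (us @ [v]) = (\<Sum>i<Suc (length us). v i * c i)"
proof -
  define n where "n = length us"
  define P where "P = (\<lambda>v. mat (Suc n) (Suc n) (\<lambda>(i, j). ((us @ [v]) ! j) i))"
  \<comment> \<open>Deleting column \<open>n\<close> removes every occurrence of \<open>v\<close>,
    so \<open>0\<close> can stand in for it.\<close>
  have del: "mat_delete (P v) i n = mat_delete (P 0) i n" if "i < Suc n" for i v
    using that by (intro eq_matI) (auto simp: P_def mat_delete_def nth_append n_def)
  have "cdet (us @ [v]) = (\<Sum>i<Suc n. v i * cofactor (P 0) i n)" for v
  proof -
    have "cdet (us @ [v]) = (\<Sum>i<Suc n. P v $$ (i, n) * cofactor (P v) i n)"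
      using laplace_expansion_column[of "P v" "Suc n" n] by (simp add: cdet_def P_def n_def)
    also have "\<dots> = (\<Sum>i<Suc n. v i * cofactor (P 0) i n)"
    proof (intro sum.cong refl)
      fix i assume i: "i \<in> {..<Suc n}"
      then have "P v $$ (i, n) = v i"
        by (auto simp: P_def n_def nth_append)
      then show "P v $$ (i, n) * cofactor (P v) i n = v i * cofactor (P 0) i n"
        using del[of i v] i by (simp add: cofactor_def)
    qed
    finally show ?thesis .
  qed
  then show ?thesis
    unfolding n_def by (intro exI[of _ "\<lambda>i. cofactor (P 0) i (length us)"] allI)
qed

lemma cdet_snoc_add: "cdet (us @ [u + v]) = cdet (us @ [u]) + cdet (us @ [v])"
proof -
  obtain c where c: "\<And>v. cdet (us @ [v]) = (\<Sum>i<Suc (length us). v i * c i)"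
    using cdet_snoc_expand by metis
  show ?thesis unfolding c by (simp only: plus_fun_apply distrib_right sum.distrib)
qed

lemma cdet_snoc_scale: "cdet (us @ [\<lambda>k. a * v k]) = a * cdet (us @ [v])"
proof -
  obtain c where c: "\<And>v. cdet (us @ [v]) = (\<Sum>i<Suc (length us). v i * c i)"
    using cdet_snoc_expand by metis
  show ?thesis unfolding c by (simp only: sum_distrib_left mult.assoc)
qed

lemma cdet_not_distinct: "\<not> distinct us \<Longrightarrow> cdet us = 0"
proof -
  assume "\<not> distinct us"
  then obtain i j where ij: "i < length us" "j < length us" "i \<noteq> j" "us ! i = us ! j"
    by (auto simp: distinct_conv_nth)
  show ?thesis unfolding cdet_def
    by (rule det_identical_columns[OF _ ij(3,1,2)]) (use ij in \<open>auto intro!: eq_vecI\<close>)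
qed

text \<open>By linearity in the last column it suffices to append a vector of the list itself, which
  repeats a column.\<close>

lemma cdet_snoc_span: "v \<in> fv.span (set us) \<Longrightarrow> cdet (us @ [v]) = 0"
proof (induction rule: fv.span_induct_alt)
  case base
  then show ?case using cdet_snoc_scale[of us 0 0] by (simp add: zero_fun_def)
next
  case (step c x y)
  have "cdet (us @ [x]) = 0"
    using step by (intro cdet_not_distinct) auto
  then show ?case using step by (simp only: cdet_snoc_add cdet_snoc_scale)
qed

text \<open>A column spanned by the others can be moved to the end, where it makes the determinant
  vanish.\<close>

lemma cdet_nonzero_independent:
  assumes "cdet us \<noteq> 0"
  shows "distinct us" and "fv.independent (set us)"
proof -
  show d: "distinct us" using assms cdet_not_distinct by blast
  show "fv.independent (set us)"
  proof
    assume "fv.dependent (set us)"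
    then obtain u where u: "u \<in> set us" "u \<in> fv.span (set us - {u})"
      by (auto simp: fv.dependent_def)
    then obtain xs ys where us: "us = xs @ u # ys" by (meson split_list)
    then have "set us - {u} = set (xs @ ys)" using d by auto
    then have "cdet ((xs @ ys) @ [u]) = 0" using u cdet_snoc_span by metis
    then show False using assms cdet_move[of xs u ys] us by simp
  qed
qed

text \<open>A kernel vector of the matrix is a linear relation among the first
  \<open>length us\<close> entries; \<open>supp\<close> extends it to the whole sequences.\<close>

lemma independent_cdet_nonzero:
  assumes "distinct us" and "fv.independent (set us)"
    and supp: "\<And>u k. u \<in> set us \<Longrightarrow> length us \<le> k \<Longrightarrow> u k = 0"
  shows "cdet us \<noteq> 0"
proof
  define n where "n = length us"
  define P where "P = mat n n (\<lambda>(i, j). (us ! j) i)"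
  assume "cdet us = 0"
  then have "det P = 0" by (simp add: cdet_def P_def n_def)
  moreover have P: "P \<in> carrier_mat n n" by (simp add: P_def)
  ultimately obtain v where v: "v \<in> carrier_vec n" "v \<noteq> 0\<^sub>v n" "P *\<^sub>v v = 0\<^sub>v n"
    using det_0_iff_vec_prod_zero[OF P] by blast
  have bij: "bij_betw ((!) us) {..<n} (set us)"
    using assms(1) bij_betw_nth[of us "{..<n}" "set us"] by (simp add: n_def)
  \<comment> \<open>\<open>f\<close> recovers the position of a vector in the list, which turns the
    kernel vector into coefficients indexed by \<open>set us\<close>.\<close>
  define f where "f = the_inv_into {..<n} ((!) us)"
  have f: "f (us ! j) = j" if "j < n" for j
    using that bij by (simp add: f_def bij_betw_def the_inv_into_f_f)
  have "(\<Sum>u\<in>set us. (\<lambda>k. v $ f u * u k)) = 0"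
  proof
    fix k
    have "(\<Sum>u\<in>set us. (\<lambda>k. v $ f u * u k)) k = (\<Sum>u\<in>set us. v $ f u * u k)"
      by (rule sum_fun_apply)
    also have "\<dots> = (\<Sum>j<n. v $ j * (us ! j) k)"
      using sum.reindex_bij_betw[OF bij, of "\<lambda>u. v $ f u * u k"] f by simp
    also have "\<dots> = 0"
    proof (cases "k < n")
      case True
      then have "(\<Sum>j<n. v $ j * (us ! j) k) = (P *\<^sub>v v) $ k"
        using v(1) by (auto simp: P_def scalar_prod_def lessThan_atLeast0 mult.commute intro!: sum.cong)
      then show ?thesis using v(3) True by simp
    next
      case False
      then show ?thesis using supp by (intro sum.neutral) (auto simp: n_def)
    qed
    finally show "(\<Sum>u\<in>set us. (\<lambda>k. v $ f u * u k)) k = 0 k" by simp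
  qed
  then have z: "v $ f u = 0" if "u \<in> set us" for u
    by (rule fv.independentD[OF assms(2) finite_set subset_refl _ that])
  have "v $ j = 0" if "j < n" for j
    using f[OF that] z[of "us ! j"] that by (simp add: n_def)
  then have "v = 0\<^sub>v n" using v(1) by (intro eq_vecI) auto
  then show False using v(2) by simp
qed

section \<open>Maximal minors, bases and rank in terms of spans of columns\<close>

text \<open>
  Columns are numbered from 1, to match the ground set, and padded with zeros below the matrix.
\<close>
definition colv :: "real mat \<Rightarrow> nat \<Rightarrow> nat \<Rightarrow> real" where
  "colv A j = (\<lambda>k. if k < dim_row A then A $$ (k, j - 1) else 0)"

text \<open>Links the column selection of \<open>submatrix\<close> to sorted lists: entry
  \<open>k\<close> is the element with exactly \<open>k\<close> smaller ones. Subtracting one turns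
  it into a column number.\<close>

lemma pick_Suc_preimage:
  assumes "finite S" and "0 \<notin> S" and k: "k < card S"
  shows "pick {j. Suc j \<in> S} k = sorted_list_of_set S ! k - 1"
proof -
  define xs where "xs = sorted_list_of_set S"
  have xs: "set xs = S" "distinct xs" "length xs = card S" "sorted_wrt (<) xs"
    using assms(1) by (auto simp: xs_def strict_sorted_iff)
  define j where "j = xs ! k - 1"
  have "xs ! k \<in> S" using k xs by (metis nth_mem)
  then have j: "xs ! k = Suc j" using assms(2) by (cases "xs ! k") (auto simp: j_def)
  have "Suc ` {a \<in> {j. Suc j \<in> S}. a < j} = (!) xs ` {..<k}"
  proof (intro subset_antisym subsetI)
    fix b assume "b \<in> Suc ` {a \<in> {j. Suc j \<in> S}. a < j}"
    then have "b \<in> set xs" "b < xs ! k" using xs(1) j by auto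
    then obtain i where i: "i < length xs" "b = xs ! i" by (metis in_set_conv_nth)
    moreover have "i < k"
    proof (rule ccontr)
      assume "\<not> i < k"
      then have "xs ! k \<le> xs ! i"
        using i xs(4) by (cases "i = k") (auto simp: sorted_wrt_iff_nth_less less_imp_le)
      then show False using i \<open>b < xs ! k\<close> by simp
    qed
    ultimately show "b \<in> (!) xs ` {..<k}" by auto
  next
    fix b assume "b \<in> (!) xs ` {..<k}"
    then obtain i where i: "i < k" "b = xs ! i" by auto
    then have "b \<in> S" "b < Suc j"
      using xs(1,3) k j sorted_wrt_nth_less[OF xs(4), of i k] by auto
    moreover then obtain c where "b = Suc c" using assms(2) by (cases b) auto
    ultimately show "b \<in> Suc ` {a \<in> {j. Suc j \<in> S}. a < j}" by auto
  qed
  moreover have "inj_on ((!) xs) {..<k}"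
    using xs(2,3) k by (auto simp: inj_on_def nth_eq_iff_index_eq)
  ultimately have "card {a \<in> {j. Suc j \<in> S}. a < j} = k"
    using card_image[of Suc "{a \<in> {j. Suc j \<in> S}. a < j}"] card_image[of "(!) xs" "{..<k}"]
    by simp
  then have "pick {j. Suc j \<in> S} k = j"
    using pick_card_in_set[of j "{j. Suc j \<in> S}"] \<open>xs ! k \<in> S\<close> j by simp
  then show ?thesis by (simp add: j_def xs_def)
qed

lemma pick_UNIV: "pick UNIV i = i"
  using pick_card_in_set[of i UNIV] by simp

lemma max_minor_eq_cdet:
  assumes "S \<in> max_column_sets A"
  shows "max_minor A S = cdet (map (colv A) (sorted_list_of_set S))"
proof -
  define xs where "xs = sorted_list_of_set S"
  have S: "S \<subseteq> {1..dim_col A}" "card S = dim_row A"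
    using assms by (auto simp: max_column_sets_def)
  then have fin: "finite S" using finite_subset by blast
  have z: "0 \<notin> S" using S by auto
  have "Suc ` {j. j < dim_col A \<and> Suc j \<in> S} = S"
    using S(1) by (auto simp: image_iff Suc_le_eq gr0_conv_Suc)
       (metis One_nat_def Suc_le_D Suc_le_lessD atLeastAtMost_iff subsetD)
  then have c: "card {j. j < dim_col A \<and> Suc j \<in> S} = dim_row A"
    using card_image[of Suc "{j. j < dim_col A \<and> Suc j \<in> S}"] S(2) by simp
  have "submatrix A UNIV {j. Suc j \<in> S} =
      mat (dim_row A) (dim_row A) (\<lambda>(i, j). (map (colv A) xs ! j) i)"
    using c S pick_Suc_preimage[OF fin z]
    by (intro eq_matI) (auto simp: submatrix_def pick_UNIV colv_def xs_def)
  then show ?thesis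
    using S by (simp add: max_minor_def cdet_def xs_def)
qed

text \<open>Independence of the image set does not see repeated columns, hence
  \<open>inj_on\<close>. The zero padding in \<open>colv\<close> supplies the support condition for
  a nonzero determinant.\<close>

lemma column_bases_iff:
  "S \<in> column_bases A \<longleftrightarrow>
    S \<in> max_column_sets A \<and> inj_on (colv A) S \<and> fv.independent (colv A ` S)"
proof (cases "S \<in> max_column_sets A")
  case True
  then have S: "S \<subseteq> {1..dim_col A}" "card S = dim_row A"
    by (auto simp: max_column_sets_def)
  then have fin: "finite S" using finite_subset by blast
  let ?us = "map (colv A) (sorted_list_of_set S)"
  have us: "set ?us = colv A ` S" "distinct ?us \<longleftrightarrow> inj_on (colv A) S" "length ?us = dim_row A"
    using fin S by (auto simp: distinct_map)
  have "u k = 0" if "u \<in> set ?us" "length ?us \<le> k" for u k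
    using that us(3) by (auto simp: colv_def)
  then have "cdet ?us \<noteq> 0 \<longleftrightarrow> distinct ?us \<and> fv.independent (set ?us)"
    using cdet_nonzero_independent[of ?us] independent_cdet_nonzero[of ?us] by blast
  then show ?thesis
    using True us by (simp add: column_bases_def max_minor_eq_cdet)
qed (simp add: column_bases_def)

text \<open>A maximal independent set of columns containing those of \<open>X\<close> is at least as
  large as any base and no larger than the number of rows, so it has the size of a base.\<close>

lemma independent_extend_base:
  assumes ne: "column_bases A \<noteq> {}" and X: "X \<subseteq> {1..dim_col A}"
    and inj: "inj_on (colv A) X" and ind: "fv.independent (colv A ` X)"
  obtains B where "B \<in> column_bases A" "X \<subseteq> B"
proof -
  define E where "E = {1..dim_col A}"
  define w where "w = colv A"
  obtain B0 where "B0 \<in> column_bases A" using ne by auto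
  then have B0: "B0 \<subseteq> E" "card B0 = dim_row A" "inj_on w B0" "fv.independent (w ` B0)"
    by (auto simp: column_bases_iff max_column_sets_def E_def w_def)
  obtain C where C: "w ` X \<subseteq> C" "C \<subseteq> w ` E" "fv.independent C" "w ` E \<subseteq> fv.span C"
    using fv.maximal_independent_subset_extend[of "w ` X" "w ` E"] X ind
    by (auto simp: E_def w_def)
  have finC: "finite C" using C(2) finite_subset by (auto simp: E_def)
  have "card C \<ge> card (w ` B0)"
    using fv.independent_span_bound[OF finC B0(4)] C(4) B0(1) by blast
  then have ge: "card C \<ge> dim_row A" using B0 by (simp add: card_image)
  have le: "card C \<le> dim_row A"
  proof -
    \<comment> \<open>Unit vectors: those below \<open>dim_row A\<close> span all columns, since
      \<open>colv\<close> is zero from that row on.\<close>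
    define e where "e = (\<lambda>i::nat. (\<lambda>k. if k = i then 1 else 0) :: nat \<Rightarrow> real)"
    have "w j \<in> fv.span (e ` {..<dim_row A})" for j
    proof -
      have "w j = (\<Sum>i<dim_row A. (\<lambda>k. w j i * e i k))"
      proof
        fix k
        have "(\<Sum>i<dim_row A. (\<lambda>k. w j i * e i k)) k = (\<Sum>i<dim_row A. if k = i then w j i else 0)"
          unfolding sum_fun_apply by (intro sum.cong) (simp_all add: e_def)
        then show "w j k = (\<Sum>i<dim_row A. (\<lambda>k. w j i * e i k)) k"
          by (simp add: w_def colv_def)
      qed
      moreover have "\<dots> \<in> fv.span (e ` {..<dim_row A})"
        by (intro fv.span_sum fv.span_scale fv.span_base imageI)
      ultimately show ?thesis by simp
    qed
    then have "C \<subseteq> fv.span (e ` {..<dim_row A})" using C(2) by blast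
    then have "card C \<le> card (e ` {..<dim_row A})"
      using fv.independent_span_bound[OF _ C(3)] by blast
    then show ?thesis using card_image_le[of "{..<dim_row A}" e] by simp
  qed
  \<comment> \<open>\<open>X\<close> is kept, and one index is chosen for each remaining vector of
    \<open>C\<close>, so that \<open>w\<close> is injective on \<open>B\<close>.\<close>
  define B where "B = X \<union> inv_into E w ` (C - w ` X)"
  have inv: "w (inv_into E w c) = c" "inv_into E w c \<in> E" if "c \<in> C" for c
    using that C(2) f_inv_into_f[of c w E] inv_into_into[of c w E] by auto
  have wB: "w ` B = C" using C(1) inv by (force simp: B_def image_Un image_image)
  have BE: "B \<subseteq> E" using X inv by (auto simp: B_def E_def)
  have injB: "inj_on w B"
  proof (rule inj_onI)
    fix a b assume ab: "a \<in> B" "b \<in> B" "w a = w b"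
    have cases: "a \<in> X \<or> (w a \<in> C - w ` X \<and> a = inv_into E w (w a))" if "a \<in> B" for a
      using that inv by (auto simp: B_def)
    show "a = b"
    proof (cases "a \<in> X \<and> b \<in> X")
      case True
      then show ?thesis using inj ab(3) by (simp add: inj_on_def w_def)
    next
      case False
      then have "w a \<in> C - w ` X" "w b \<in> C - w ` X"
        using cases[OF ab(1)] cases[OF ab(2)] ab(3) by auto
      then have "a \<notin> X" "b \<notin> X" by auto
      then show ?thesis using cases[OF ab(1)] cases[OF ab(2)] ab(3) by metis
    qed
  qed
  have "card B = dim_row A"
    using wB card_image[OF injB] ge le by simp
  then have "B \<in> column_bases A"
    using BE injB wB C(3) by (auto simp: column_bases_iff max_column_sets_def E_def w_def)
  then show ?thesis using that[of B] by (auto simp: B_def)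
qed

lemma finite_column_bases: "finite (column_bases A)"
  by (rule finite_subset[of _ "Pow {1..dim_col A}"])
    (auto simp: column_bases_def max_column_sets_def)

text \<open>Bases of the matroid consist of indices, not vectors, so a basis of the span is pulled
  back along \<open>w\<close>.\<close>

lemma spanning_index_subset:
  fixes w :: "nat \<Rightarrow> nat \<Rightarrow> real"
  obtains X where "X \<subseteq> T" "inj_on w X" "fv.independent (w ` X)" "w ` T \<subseteq> fv.span (w ` X)"
    "card X = fv.dim (w ` T)"
proof -
  obtain C where C: "C \<subseteq> w ` T" "fv.independent C" "w ` T \<subseteq> fv.span C" "card C = fv.dim (w ` T)"
    using fv.basis_exists by blast
  obtain X where X: "X \<subseteq> T" "inj_on w X" "C = w ` X"
    using C(1) by (meson subset_image_inj)
  show ?thesis using that[of X] X C by (simp add: card_image)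
qed

text \<open>The part of a base inside \<open>T\<close> is independent, so the dimension bounds it.
  Extending a basis of the span to a base attains the bound.\<close>

lemma rk_column_bases:
  assumes ne: "column_bases A \<noteq> {}" and T: "T \<subseteq> {1..dim_col A}"
  shows "rk (column_bases A) T = fv.dim (colv A ` T)"
proof -
  define w where "w = colv A"
  obtain X where X: "X \<subseteq> T" "inj_on w X" "fv.independent (w ` X)" "w ` T \<subseteq> fv.span (w ` X)"
    "card X = fv.dim (w ` T)"
    by (rule spanning_index_subset)
  have finT: "finite T" using T finite_subset by blast
  then have finX: "finite X" using X(1) finite_subset by blast
  have upper: "card (B \<inter> T) \<le> card X" if "B \<in> column_bases A" for B
  proof -
    have B: "inj_on w B" "fv.independent (w ` B)"
      using that by (auto simp: column_bases_iff w_def)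
    have "fv.independent (w ` (B \<inter> T))" using fv.independent_mono[OF B(2)] by (simp add: image_mono)
    then have "card (w ` (B \<inter> T)) \<le> card (w ` X)"
      using fv.independent_span_bound[of "w ` X" "w ` (B \<inter> T)"] finX X(4) by blast
    moreover have "inj_on w (B \<inter> T)" using B(1) by (meson Int_lower1 inj_on_subset)
    ultimately show ?thesis using X(2) by (simp add: card_image)
  qed
  obtain B where B: "B \<in> column_bases A" "X \<subseteq> B"
    using independent_extend_base[OF ne, of X] X T unfolding w_def by (metis subset_trans)
  have "card X \<le> card (B \<inter> T)" using B(2) X(1) finT by (intro card_mono) auto
  then have "card (B \<inter> T) = card X" using upper[OF B(1)] by simp
  then have "rk (column_bases A) T = card X"
    unfolding rk_def using upper B(1) finite_column_bases
    by (intro Max_eqI) (auto intro: image_eqI[of _ _ B])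
  then show ?thesis using X(5) by (simp add: w_def)
qed

lemma dim_insert_eq_iff:
  assumes "finite S"
  shows "fv.dim (insert a S) = fv.dim S \<longleftrightarrow> a \<in> fv.span S"
proof
  assume "a \<in> fv.span S"
  then show "fv.dim (insert a S) = fv.dim S"
    using fv.span_redundant fv.dim_span by metis
next
  assume eq: "fv.dim (insert a S) = fv.dim S"
  show "a \<in> fv.span S"
  proof (rule ccontr)
    assume a: "a \<notin> fv.span S"
    obtain C where C: "C \<subseteq> S" "fv.independent C" "S \<subseteq> fv.span C" "card C = fv.dim S"
      using fv.basis_exists by blast
    have sp: "fv.span C = fv.span S"
      using C(1,3) fv.span_mono fv.span_minimal fv.subspace_span by (metis subset_antisym)
    have "fv.independent (insert a C)" using a C(2) sp fv.independent_insertI by simp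
    moreover have "insert a S \<subseteq> fv.span (insert a C)"
      using C(3) fv.span_mono[of C "insert a C"] fv.span_base[of a "insert a C"] by blast
    ultimately have "card (insert a C) = fv.dim (insert a S)"
      using C(1) by (intro fv.basis_card_eq_dim) auto
    moreover have "finite C" "a \<notin> C"
      using C(1) assms finite_subset a fv.span_base by blast+
    ultimately show False using eq C(4) by simp
  qed
qed

text \<open>Translates membership in the matroid closure of \<open>T\<close> into membership in a
  span.\<close>

lemma rk_insert_eq_iff:
  assumes "column_bases A \<noteq> {}" and "T \<subseteq> {1..dim_col A}" and "s \<in> {1..dim_col A}"
  shows "rk (column_bases A) (insert s T) = rk (column_bases A) T \<longleftrightarrow>
    colv A s \<in> fv.span (colv A ` T)"
  using assms dim_insert_eq_iff[of "colv A ` T" "colv A s"] finite_subset[OF assms(2)]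
  by (simp add: rk_column_bases)

section \<open>Deletion of rows\<close>

lemma span_first_rows:
  assumes "x \<in> fv.span S"
  shows "(\<lambda>k. if k < r then x k else 0) \<in> fv.span ((\<lambda>f k. if k < r then f k else 0) ` S)"
  using assms
proof (induction rule: fv.span_induct_alt)
  case base
  have "(\<lambda>k. if k < r then (0::nat \<Rightarrow> real) k else 0) = 0" by auto
  then show ?case using fv.span_zero by metis
next
  case (step c x y)
  have "(\<lambda>k. if k < r then ((\<lambda>k. c * x k) + y) k else 0) =
      (\<lambda>k. c * (if k < r then x k else 0)) + (\<lambda>k. if k < r then y k else 0)"
    by auto
  moreover have "\<dots> \<in> fv.span ((\<lambda>f k. if k < r then f k else 0) ` S)"
    using step by (intro fv.span_add[OF fv.span_scale[OF fv.span_base]]) auto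
  ultimately show ?case by (simp only:)
qed

lemma colv_first_rows:
  assumes "A \<in> carrier_mat d n" "r \<le> d" "j \<in> {1..n}"
  shows "colv (first_rows r A) j = (\<lambda>k. if k < r then colv A j k else 0)"
proof -
  have pick: "pick {..<r} i = i" if "i < r" for i
  proof -
    have "{a \<in> {..<r}. a < i} = {..<i}" using that by auto
    then show ?thesis using pick_card_in_set[of i "{..<r}"] that by simp
  qed
  have "{i. i < dim_row A \<and> i \<in> {..<r}} = {..<r}" using assms by auto
  then show ?thesis
    using assms pick by (auto simp: colv_def first_rows_def submatrix_def pick_UNIV)
qed

text \<open>Truncation is linear and so preserves dependencies. By contraposition, a column outside
  a span after the deletion was outside it before; this is how concordance is used.\<close>

lemma span_colv_first_rows:
  assumes A: "A \<in> carrier_mat d n" "r \<le> d" and T: "T \<subseteq> {1..n}" "s \<in> {1..n}"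
    and "colv A s \<in> fv.span (colv A ` T)"
  shows "colv (first_rows r A) s \<in> fv.span (colv (first_rows r A) ` T)"
proof -
  have "colv (first_rows r A) ` T = (\<lambda>f k. if k < r then f k else 0) ` colv A ` T"
    using colv_first_rows[OF A] T unfolding image_image by (intro image_cong) auto
  then show ?thesis using span_first_rows[OF assms(5), of r] colv_first_rows[OF A T(2)] by simp
qed

section \<open>Signs of exchanges and crossing pairs\<close>

text \<open>On its way to the end, column \<open>p\<close> passes exactly the columns of the larger
  elements of \<open>J\<close>, with one sign change for each.\<close>

lemma max_minor_insert:
  assumes J: "finite J" "p \<notin> J" and max: "insert p J \<in> max_column_sets A"
  shows "max_minor A (insert p J) =
    (-1) ^ card {j \<in> J. p < j} * cdet (map (colv A) (sorted_list_of_set J) @ [colv A p])"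
proof -
  define us where "us = sorted_list_of_set {j \<in> J. j < p}"
  define vs where "vs = sorted_list_of_set {j \<in> J. p < j}"
  have sets: "set us = {j \<in> J. j < p}" "set vs = {j \<in> J. p < j}"
    using J by (simp_all add: us_def vs_def)
  have sd: "sorted us" "distinct us" "sorted vs" "distinct vs"
    by (simp_all add: us_def vs_def)
  have split: "J = {j \<in> J. j < p} \<union> {j \<in> J. p < j}"
  proof -
    have "j < p \<or> p < j" if "j \<in> J" for j
      using that J(2) by (cases j p rule: linorder_cases) auto
    then show ?thesis by auto
  qed
  have len: "length vs = card {j \<in> J. p < j}"
    using J by (simp add: vs_def)
  have "set (us @ vs) = J" unfolding set_append sets by (rule split[symmetric])
  then have set_eq: "set (sorted_list_of_set J) = set (us @ vs)"
    "set (sorted_list_of_set (insert p J)) = set (us @ p # vs)"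
    using set_sorted_list_of_set[of J] set_sorted_list_of_set[of "insert p J"] J(1) by auto
  have "sorted (us @ vs)" "distinct (us @ vs)" "sorted (us @ p # vs)" "distinct (us @ p # vs)"
    using sd by (auto simp: sorted_append sets)
  from sorted_distinct_set_unique[OF sorted_sorted_list_of_set distinct_sorted_list_of_set this(1,2) set_eq(1)]
    sorted_distinct_set_unique[OF sorted_sorted_list_of_set distinct_sorted_list_of_set this(3,4) set_eq(2)]
  have "sorted_list_of_set J = us @ vs" "sorted_list_of_set (insert p J) = us @ p # vs" .
  then show ?thesis
    using max_minor_eq_cdet[OF max] cdet_move[of "map (colv A) us" "colv A p" "map (colv A) vs"] len
    by simp
qed

text \<open>
  The sign is stated with the elements above \<open>p\<close> and above \<open>q\<close>; those above both cancel.
\<close>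
lemma max_minor_exchange:
  assumes J: "finite J" "p \<notin> J" "q \<notin> J"
    and max: "insert p J \<in> max_column_sets A" "insert q J \<in> max_column_sets A"
    and span: "colv A q - (\<lambda>k. c * colv A p k) \<in> fv.span (colv A ` J)"
  shows "max_minor A (insert q J) =
    (-1) ^ (card {j \<in> J. p < j} + card {j \<in> J. q < j}) * c * max_minor A (insert p J)"
proof -
  define us where "us = map (colv A) (sorted_list_of_set J)"
  define u where "u = colv A q - (\<lambda>k. c * colv A p k)"
  have "colv A q = u + (\<lambda>k. c * colv A p k)" by (simp add: u_def)
  then have "cdet (us @ [colv A q]) = cdet (us @ [u]) + c * cdet (us @ [colv A p])"
    by (simp only: cdet_snoc_add cdet_snoc_scale)
  moreover have "cdet (us @ [u]) = 0"
    using span J(1) by (intro cdet_snoc_span) (simp add: us_def u_def)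
  ultimately have q: "cdet (us @ [colv A q]) = c * cdet (us @ [colv A p])" by simp
  have sq: "((-1) ^ k * ((-1) ^ k * a)) = a" for k and a :: real
    by (simp flip: mult.assoc power_mult_distrib)
  show ?thesis
    using max_minor_insert[OF J(1,2) max(1)] max_minor_insert[OF J(1,3) max(2)] q
    by (simp add: us_def power_add sq mult.assoc mult.left_commute)
qed

text \<open>A nonzero vector has a nonzero coefficient in its expansion; splitting off that term
  yields the partner for an exchange.\<close>

lemma span_member_pivot:
  fixes w :: "nat \<Rightarrow> nat \<Rightarrow> real"
  assumes "finite X" "inj_on w X" "v \<in> fv.span (w ` X)" "v \<noteq> 0"
  obtains i c where "i \<in> X" "c \<noteq> 0" "v - (\<lambda>k. c * w i k) \<in> fv.span (w ` (X - {i}))"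
proof -
  obtain u where u: "v = (\<Sum>z\<in>w ` X. (\<lambda>k. u z * z k))"
    using assms(3) fv.span_finite[of "w ` X"] assms(1) by auto
  have "\<exists>z\<in>w ` X. u z \<noteq> 0"
  proof (rule ccontr)
    assume "\<not> ?thesis"
    then have "v = (\<Sum>z\<in>w ` X. 0)"
      unfolding u by (intro sum.cong) (auto simp: zero_fun_def)
    then show False using assms(4) by simp
  qed
  then obtain i where i: "i \<in> X" "u (w i) \<noteq> 0" by auto
  have "v = (\<lambda>k. u (w i) * w i k) + (\<Sum>z\<in>w ` X - {w i}. (\<lambda>k. u z * z k))"
    unfolding u using assms(1) i(1) by (intro sum.remove) auto
  moreover have "w ` X - {w i} = w ` (X - {i})"
    using assms(2) i(1) by (auto simp: inj_on_def)
  moreover have "(\<Sum>z\<in>w ` (X - {i}). (\<lambda>k. u z * z k)) \<in> fv.span (w ` (X - {i}))"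
    by (intro fv.span_sum fv.span_scale fv.span_base)
  ultimately have "v - (\<lambda>k. u (w i) * w i k) \<in> fv.span (w ` (X - {i}))"
    by simp
  then show ?thesis using that i by blast
qed

lemma neg_one_power_same_sign:
  fixes a :: real
  assumes "0 < (-1) ^ m * a" and "0 < (-1) ^ n * a"
  shows "even m \<longleftrightarrow> even n"
  using assms by (cases "even m"; cases "even n") simp_all

text \<open>\<open>cross\<close> says that exactly one of \<open>x\<close> and \<open>y\<close> lies
  between \<open>i\<close> and \<open>s\<close>. Exchanging \<open>i\<close> for \<open>s\<close>
  next to \<open>x\<close> and next to \<open>y\<close> therefore yields opposite signs of the same
  factor \<alpha>, while all minors are nonnegative.\<close>

lemma nonneg_minors_no_crossing:
  assumes nonneg: "\<And>S. S \<in> max_column_sets A \<Longrightarrow> 0 \<le> max_minor A S"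
    and ne: "column_bases A \<noteq> {}"
    and E: "I \<subseteq> {1..dim_col A}" "x \<in> {1..dim_col A}" "y \<in> {1..dim_col A}" "s \<in> {1..dim_col A}"
    and s: "s \<notin> I" "s \<noteq> x" "s \<noteq> y"
    and cross: "\<And>i. i \<in> I \<Longrightarrow> ((i < x) \<noteq> (s < x)) \<noteq> ((i < y) \<noteq> (s < y))"
    and y_in: "colv A y \<in> fv.span (colv A ` insert x I)"
    and y_out: "colv A y \<notin> fv.span (colv A ` I)"
    and s_in: "colv A s \<in> fv.span (colv A ` I)" and s_nz: "colv A s \<noteq> 0"
    and xy: "x \<noteq> y"
  shows False
proof -
  define w where "w = colv A"
  obtain X where X: "X \<subseteq> I" "inj_on w X" "fv.independent (w ` X)" "w ` I \<subseteq> fv.span (w ` X)"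
    by (rule spanning_index_subset)
  have finX: "finite X" using X(1) E(1) finite_subset by (metis finite_atLeastAtMost)
  have spX: "fv.span (w ` X) = fv.span (w ` I)"
    using X(1,4) fv.span_mono[of "w ` X" "w ` I"] fv.span_minimal[OF X(4) fv.subspace_span]
    by blast
  have x_out: "w x \<notin> fv.span (w ` X)"
    using y_in y_out fv.span_redundant[of "w x" "w ` I"] spX by (auto simp: w_def)
  obtain i \<alpha> where i: "i \<in> X" "\<alpha> \<noteq> 0" "w s - (\<lambda>k. \<alpha> * w i k) \<in> fv.span (w ` (X - {i}))"
    using span_member_pivot[OF finX X(2)] s_in s_nz spX by (metis w_def)
  have "w y \<in> fv.span (insert (w x) (w ` X))"
  proof -
    have "insert (w x) (w ` I) \<subseteq> fv.span (insert (w x) (w ` X))"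
      using X(4) fv.span_mono[of "w ` X" "insert (w x) (w ` X)"]
        fv.span_base[of "w x" "insert (w x) (w ` X)"] by blast
    from fv.span_minimal[OF this fv.subspace_span] show ?thesis
      using y_in by (auto simp: w_def)
  qed
  then obtain \<beta> where \<beta>: "w y - (\<lambda>k. \<beta> * w x k) \<in> fv.span (w ` X)"
    unfolding fv.span_breakdown_eq by blast
  have \<beta>0: "\<beta> \<noteq> 0"
  proof
    assume "\<beta> = 0"
    then have "w y - (\<lambda>k. \<beta> * w x k) = w y" by auto
    then have "w y \<in> fv.span (w ` X)" using \<beta> by (simp only:)
    then show False using y_out spX unfolding w_def by blast
  qed
  have "w x \<notin> w ` X" using x_out fv.span_base[of "w x" "w ` X"] by blast
  then have injx: "inj_on w (insert x X)" using X(2) by auto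
  moreover have "fv.independent (w ` insert x X)"
    using x_out X(3) fv.independent_insertI by simp
  moreover have "insert x X \<subseteq> {1..dim_col A}" using X(1) E by auto
  \<comment> \<open>\<open>B\<close> contains all of \<open>X\<close>, so the relations for
    \<open>s\<close> and \<open>y\<close> hold modulo elements of \<open>B\<close>.\<close>
  ultimately obtain B where B: "B \<in> column_bases A" "insert x X \<subseteq> B"
    using independent_extend_base[OF ne, of "insert x X"] unfolding w_def by blast
  have B': "B \<subseteq> {1..dim_col A}" "card B = dim_row A" "inj_on w B" "fv.independent (w ` B)"
    "max_minor A B \<noteq> 0" "B \<in> max_column_sets A"
    using B(1) column_bases_iff[of B A] by (auto simp: max_column_sets_def w_def column_bases_def)
  have finB: "finite B" using B'(1) finite_subset by blast
  have not_in_B: "q \<notin> B" if q: "w q \<in> fv.span (w ` Z)" "Z \<subseteq> B" "q \<notin> Z" for q Z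
  proof
    assume "q \<in> B"
    then have "w q \<notin> w ` Z" using q B'(3) by (auto simp: inj_on_def)
    then have "w ` Z \<subseteq> w ` B - {w q}"
      using image_mono[OF q(2), of w] by blast
    from fv.span_mono[OF this] have "w q \<in> fv.span (w ` B - {w q})" using q(1) by blast
    then show False using B'(4) \<open>q \<in> B\<close> unfolding fv.dependent_def by blast
  qed
  have sB: "s \<notin> B" using not_in_B[of s X] s_in spX X(1) s(1) B(2) by (auto simp: w_def)
  have "y \<notin> I" using y_out fv.span_base[of "colv A y" "colv A ` I"] by blast
  then have yB: "y \<notin> B"
    using not_in_B[of y "insert x X"] \<open>w y \<in> fv.span (insert (w x) (w ` X))\<close> X(1) B(2) xy by auto
  have x: "x \<in> B" "x \<noteq> i" "i \<in> B" "x \<notin> X" using B(2) i(1) \<open>w x \<notin> w ` X\<close> by auto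
  \<comment> \<open>All minors compared below belong to \<open>J\<close> with one of
    \<open>i\<close>, \<open>s\<close> and one of \<open>x\<close>, \<open>y\<close> added.\<close>
  define J where "J = B - {i, x}"
  have J: "finite J" "i \<notin> J" "x \<notin> J" "y \<notin> J" "s \<notin> J" "B = insert i (insert x J)"
    using finB sB yB x by (auto simp: J_def)
  have yi: "y \<noteq> i" "s \<noteq> i" "y \<noteq> s" using yB sB x s by auto
  have cJ: "Suc (Suc (card J)) = dim_row A" using B'(2) J x by simp
  have JE: "J \<subseteq> {1..dim_col A}" "i \<in> {1..dim_col A}" using B'(1) J by auto
  have max: "insert a (insert b J) \<in> max_column_sets A"
    if "a \<in> {1..dim_col A}" "b \<in> {1..dim_col A}" "a \<notin> J" "b \<notin> J" "a \<noteq> b" for a b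
    using that JE cJ J(1) by (simp add: max_column_sets_def)
  have XJ: "w ` (X - {i}) \<subseteq> w ` insert b J" for b
    using B(2) x by (auto simp: J_def)
  \<comment> \<open>The rest of \<open>X\<close> lies in \<open>J\<close> or is absorbed by
    \<open>b\<close>, so the same \<alpha> serves for \<open>b = x\<close> and for
    \<open>b = y\<close>.\<close>
  have s_span: "w s - (\<lambda>k. \<alpha> * w i k) \<in> fv.span (w ` insert b J)" for b
    using i(3) fv.span_mono[OF XJ] by blast
  have y_span: "w y - (\<lambda>k. \<beta> * w x k) \<in> fv.span (w ` insert i J)"
  proof -
    have "X \<subseteq> insert i J" using B(2) x by (auto simp: J_def)
    then show ?thesis using \<beta> fv.span_mono[OF image_mono] by blast
  qed
  \<comment> \<open>Exchanging \<open>x\<close> for \<open>y\<close> multiplies the minor of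
    \<open>B\<close> by the nonzero \<beta> up to sign, so the result is again a base.\<close>
  have "max_minor A (insert y (insert i J)) \<noteq> 0"
    using max_minor_exchange[of "insert i J" x y A \<beta>] y_span \<beta>0 B'(5) J x yi
      max[of x i] max[of y i] E JE by (simp add: w_def insert_commute)
  then have pos_y: "0 < max_minor A (insert i (insert y J))"
    using nonneg[OF max[of i y]] E JE J yi by (simp add: insert_commute)
  have pos_x: "0 < max_minor A (insert i (insert x J))"
    using nonneg[OF B'(6)] B'(5) J(6) by simp
  have sign: "0 < (-1) ^ (card {j \<in> insert b J. i < j} + card {j \<in> insert b J. s < j}) * \<alpha>"
    if b: "b \<in> {1..dim_col A}" "b \<notin> J" "b \<noteq> i" "b \<noteq> s"
      and pos: "0 < max_minor A (insert i (insert b J))" for b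
  proof -
    have eq: "max_minor A (insert s (insert b J)) =
        (-1) ^ (card {j \<in> insert b J. i < j} + card {j \<in> insert b J. s < j}) * \<alpha> *
          max_minor A (insert i (insert b J))"
      using max_minor_exchange[of "insert b J" i s A \<alpha>] s_span[of b] J b yi
        max[of i b] max[of s b] E JE by (auto simp: w_def)
    have "0 \<le> max_minor A (insert s (insert b J))"
      using nonneg[OF max[of s b]] E b J by auto
    then have "0 \<le> (-1) ^ (card {j \<in> insert b J. i < j} + card {j \<in> insert b J. s < j}) * \<alpha>"
      unfolding eq using pos by (simp add: zero_le_mult_iff)
    moreover have "(-1) ^ (card {j \<in> insert b J. i < j} + card {j \<in> insert b J. s < j}) * \<alpha> \<noteq> 0"
      using i(2) by simp
    ultimately show ?thesis by linarith
  qed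
  have card_insert_filter: "card {j \<in> insert b J. a < j} = card {j \<in> J. a < j} + of_bool (a < b)"
    if "b \<notin> J" for a b
  proof -
    have "{j \<in> insert b J. a < j} = (if a < b then insert b {j \<in> J. a < j} else {j \<in> J. a < j})"
      by auto
    then show ?thesis using that J(1) by simp
  qed
  have parity: "even (card {j \<in> insert x J. i < j} + card {j \<in> insert x J. s < j}) \<longleftrightarrow>
      even (card {j \<in> insert y J. i < j} + card {j \<in> insert y J. s < j})"
  proof (rule neg_one_power_same_sign)
    show "0 < (-1) ^ (card {j \<in> insert x J. i < j} + card {j \<in> insert x J. s < j}) * \<alpha>"
      using x(2) s(2) by (intro sign E J(3) pos_x) auto
    show "0 < (-1) ^ (card {j \<in> insert y J. i < j} + card {j \<in> insert y J. s < j}) * \<alpha>"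
      by (intro sign E J(4) pos_y yi)
  qed
  have even_of_bool: "even (of_bool b :: nat) \<longleftrightarrow> \<not> b" for b
    by (cases b) simp_all
  \<comment> \<open>The counts over \<open>J\<close> are common to both sides. What remains is
    whether \<open>x\<close>, respectively \<open>y\<close>, lies between \<open>i\<close> and
    \<open>s\<close>.\<close>
  with parity show False
    using cross[OF subsetD[OF X(1) i(1)]]
    unfolding card_insert_filter[OF J(3)] card_insert_filter[OF J(4)] even_add even_of_bool
    by argo
qed

section \<open>Cyclic positions and intervals\<close>

lemma cyc_pos_eq:
  assumes "a \<in> {1..n}" "x \<in> {1..n}"
  shows "cyc_pos n a x = (if a \<le> x then x - a else x + n - a)"
proof (cases "a \<le> x")
  case True
  then have "x + n - a = (x - a) + n" by simp
  then have "(x + n - a) mod n = (x - a) mod n" by (metis mod_add_self2)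
  moreover have "x - a < n" using assms True by auto
  ultimately show ?thesis using True by (simp add: cyc_pos_def)
next
  case False
  then have "x + n - a < n" using assms by auto
  then show ?thesis using False by (simp add: cyc_pos_def)
qed

lemma cyc_pos_less: "x \<in> {1..n} \<Longrightarrow> cyc_pos n a x < n"
  by (simp add: cyc_pos_def)

lemma cyc_pos_self: "a \<in> {1..n} \<Longrightarrow> cyc_pos n a a = 0"
  by (simp add: cyc_pos_eq)

lemma cyc_pos_inj:
  assumes "x \<in> {1..n}" "u \<in> {1..n}" "v \<in> {1..n}" "cyc_pos n x u = cyc_pos n x v"
  shows "u = v"
  using assms by (auto simp: cyc_pos_eq split: if_splits)

lemma cyc_pos_surj:
  assumes "x \<in> {1..n}" "k < n"
  obtains u where "u \<in> {1..n}" "cyc_pos n x u = k"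
proof (cases "x + k \<le> n")
  case True
  then show ?thesis using that[of "x + k"] assms by (simp add: cyc_pos_eq)
next
  case False
  then have "x + k - n \<in> {1..n}" "x + k - n < x" using assms by auto
  then show ?thesis using that[of "x + k - n"] assms False by (simp add: cyc_pos_eq)
qed

lemma cyc_pos_rebase:
  assumes "x \<in> {1..n}" "a \<in> {1..n}" "u \<in> {1..n}"
  shows "cyc_pos n a u =
    (if cyc_pos n x a \<le> cyc_pos n x u then cyc_pos n x u - cyc_pos n x a
     else cyc_pos n x u + n - cyc_pos n x a)"
  using assms by (auto simp: cyc_pos_eq)

text \<open>Seen from a fixed \<open>x\<close>, an interval is either an ordinary one or wraps
  around past \<open>x\<close>. Cyclic arguments thus become comparisons of numbers.\<close>

lemma cyc_interval_rebase:
  assumes "x \<in> {1..n}" "a \<in> {1..n}" "b \<in> {1..n}"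
  shows "u \<in> cyc_interval n a b \<longleftrightarrow> u \<in> {1..n} \<and>
    (if cyc_pos n x a \<le> cyc_pos n x b
     then cyc_pos n x a \<le> cyc_pos n x u \<and> cyc_pos n x u \<le> cyc_pos n x b
     else cyc_pos n x a \<le> cyc_pos n x u \<or> cyc_pos n x u \<le> cyc_pos n x b)"
proof (cases "u \<in> {1..n}")
  case True
  have "cyc_pos n x u < n" "cyc_pos n x a < n" "cyc_pos n x b < n"
    using cyc_pos_less assms True by blast+
  then show ?thesis
    using True cyc_pos_rebase[OF assms(1,2) True] cyc_pos_rebase[OF assms]
    unfolding cyc_interval_def by (auto split: if_splits)
next
  case False
  then show ?thesis by (auto simp: cyc_interval_def)
qed

lemma cyc_succ_in: "a \<in> {1..n} \<Longrightarrow> cyc_succ n a \<in> {1..n}"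
  by (auto simp: cyc_succ_def)

lemma cyc_pos_succ:
  assumes "x \<in> {1..n}" "a \<in> {1..n}"
  shows "cyc_pos n x (cyc_succ n a) =
    (if Suc (cyc_pos n x a) = n then 0 else Suc (cyc_pos n x a))"
  using assms cyc_succ_in[OF assms(2)] by (auto simp: cyc_pos_eq cyc_succ_def)

text \<open>The case \<open>i = j\<close> is excluded because the interval from the successor of
  \<open>i\<close> to \<open>i\<close> runs all the way round.\<close>

lemma cyc_interval_insert_start:
  assumes "i \<in> {1..n}" "j \<in> {1..n}" "i \<noteq> j"
  shows "cyc_interval n i j = insert i (cyc_interval n (cyc_succ n i) j)"
proof -
  note i = assms(1) and j = assms(2)
  have pos: "0 < cyc_pos n i j"
    using cyc_pos_inj[OF i i j] cyc_pos_self[OF i] assms(3) by fastforce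
  have lt: "cyc_pos n i j < n" using cyc_pos_less j by blast
  have succ: "cyc_pos n i (cyc_succ n i) = 1"
    using pos lt cyc_pos_succ[OF i i] cyc_pos_self[OF i] by simp
  show ?thesis
  proof (rule Set.set_eqI)
    fix u
    show "u \<in> cyc_interval n i j \<longleftrightarrow> u \<in> insert i (cyc_interval n (cyc_succ n i) j)"
    proof (cases "u \<in> {1..n}")
      case True
      have "cyc_pos n i u = 0 \<longleftrightarrow> u = i"
        using cyc_pos_inj[OF i True i] cyc_pos_self[OF i] by metis
      then show ?thesis
        using True pos succ cyc_interval_rebase[OF i i j, of u]
          cyc_interval_rebase[OF i cyc_succ_in[OF i] j, of u] cyc_pos_self[OF i]
        by (auto simp: Suc_le_eq)
    qed (use i in \<open>auto simp: cyc_interval_def\<close>)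
  qed
qed

section \<open>From rank drops to arrows and flats\<close>

lemma drop_at_iff_span:
  assumes "A \<in> carrier_mat d n" "column_bases A \<noteq> {}" "i \<in> {1..n}" "j \<in> {1..n}" "i \<noteq> j"
  shows "drop_at n (column_bases A) i j \<longleftrightarrow>
    colv A i \<in> fv.span (colv A ` cyc_interval n (cyc_succ n i) j)"
  unfolding drop_at_def cyc_interval_insert_start[OF assms(3-5)]
  using assms by (intro rk_insert_eq_iff) (auto simp: cyc_interval_def)

lemma loopless_colv_nonzero:
  assumes "loopless {1..n} (column_bases A)" "s \<in> {1..n}"
  shows "colv A s \<noteq> 0"
proof -
  obtain B where "B \<in> column_bases A" "s \<in> B"
    using assms unfolding loopless_def by blast
  then have "fv.independent (colv A ` B)" "colv A s \<in> colv A ` B"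
    by (auto simp: column_bases_iff)
  then show ?thesis using fv.dependent_zero by metis
qed

text \<open>Elements after \<open>s\<close> are added to the complement, from \<open>y\<close>
  backwards. Without a covering arrow none of them enlarges the intersection with the span of the
  complement and \<open>[x, s]\<close>, yet \<open>s\<close> ends up in that intersection.\<close>

lemma arrow_covering_flat_complement:
  assumes A: "A \<in> carrier_mat d n" and ne: "column_bases A \<noteq> {}"
    and dp: "decorated_permutation n (column_bases A) \<pi>"
    and x: "x \<in> {1..n}" and y: "y \<in> {1..n}" and s: "s \<in> cyc_interval n x y"
    and flat: "colv A s \<notin> fv.span (colv A ` ({1..n} - cyc_interval n x y))"
  shows "\<exists>I \<in> ccw_arrows n \<pi>. s \<in> I \<and> I \<subseteq> cyc_interval n x y"
proof (rule ccontr)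
  assume no_arrow: "\<not> ?thesis"
  define w where "w = colv A"
  define c where "c = cyc_pos n x"
  \<comment> \<open>\<open>U k\<close> is the tail from position \<open>k\<close> on, in the order
    starting at \<open>x\<close>; \<open>Q\<close> is the interval from \<open>x\<close> to
    \<open>s\<close>.\<close>
  define U where "U k = {u \<in> {1..n}. k \<le> c u}" for k
  define Q where "Q = {u \<in> {1..n}. c u \<le> c s}"
  define I where "I = {1..n} - cyc_interval n x y"
  have interval: "u \<in> cyc_interval n a b \<longleftrightarrow> u \<in> {1..n} \<and>
      (if c a \<le> c b then c a \<le> c u \<and> c u \<le> c b else c a \<le> c u \<or> c u \<le> c b)"
    if "a \<in> {1..n}" "b \<in> {1..n}" for a b u
    using cyc_interval_rebase[OF x that] unfolding c_def .
  have cx: "c x = 0" using cyc_pos_self[OF x] by (simp add: c_def)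
  have sE: "s \<in> {1..n}" and cs: "c s \<le> c y"
    using s interval[OF x y, of s] cx by auto
  have I_eq: "I = U (Suc (c y))"
  proof (rule Set.set_eqI)
    fix u
    show "u \<in> I \<longleftrightarrow> u \<in> U (Suc (c y))"
      using interval[OF x y, of u] cx by (auto simp: I_def U_def)
  qed
  have clt: "c u < n" if "u \<in> {1..n}" for u using cyc_pos_less[OF that] by (simp add: c_def)
  have cinj: "u = v" if "u \<in> {1..n}" "v \<in> {1..n}" "c u = c v" for u v
    using cyc_pos_inj[OF x that(1,2)] that(3) by (simp add: c_def)
  have csucc: "c (cyc_succ n a) = (if Suc (c a) = n then 0 else Suc (c a))" if "a \<in> {1..n}" for a
    using cyc_pos_succ[OF x that] by (simp add: c_def)
  have perm: "\<pi> permutes {1..n}" using dp by (simp add: decorated_permutation_def)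
  \<comment> \<open>Were \<open>\<pi> t\<close> at or before \<open>s\<close>, the arrow from
    \<open>\<pi> t\<close> to \<open>t\<close> would contain \<open>s\<close> and stay inside the
    interval.\<close>
  have no: "c s < c (\<pi> t)" if t: "t \<in> {1..n}" "c s \<le> c t" "c t \<le> c y" for t
  proof (rule ccontr)
    assume le: "\<not> c s < c (\<pi> t)"
    have z: "\<pi> t \<in> {1..n}" using perm t(1) permutes_in_image by metis
    have "inv_into {1..n} \<pi> (\<pi> t) = t"
      using perm t(1) permutes_inj_on by (metis inv_into_f_f)
    then have "cyc_interval n (\<pi> t) t \<in> ccw_arrows n \<pi>"
      using z by (force simp: ccw_arrows_def)
    moreover have "s \<in> cyc_interval n (\<pi> t) t"
      using interval[OF z t(1), of s] sE le t by auto
    moreover have "cyc_interval n (\<pi> t) t \<subseteq> cyc_interval n x y"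
    proof
      fix u assume "u \<in> cyc_interval n (\<pi> t) t"
      then show "u \<in> cyc_interval n x y"
        using interval[OF z t(1), of u] interval[OF x y, of u] cx le t by auto
    qed
    ultimately show False using no_arrow by blast
  qed
  \<comment> \<open>The first alternative occurs if \<open>\<pi> t\<close> comes after
    \<open>t\<close>, the second if the list from \<open>t\<close> wraps around past
    \<open>x\<close>.\<close>
  have first_drop: "w t \<in> fv.span (w ` U (Suc (c t))) \<or>
      c s < c t \<and> w t \<notin> fv.span (w ` (U (Suc (c t)) \<union> Q))"
    if t: "t \<in> {1..n}" "c s \<le> c t" "c t \<le> c y" for t
  proof -
    have z: "\<pi> t \<in> {1..n}" using perm t(1) permutes_in_image by metis
    have pt: "\<pi> t \<noteq> t" "drop_at n (column_bases A) t (\<pi> t)"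
      and first: "\<And>j. j \<in> {1..n} - {t} \<Longrightarrow> cyc_pos n t j < cyc_pos n t (\<pi> t) \<Longrightarrow>
        \<not> drop_at n (column_bases A) t j"
      using dp t(1) by (auto simp: decorated_permutation_def)
    have succE: "cyc_succ n t \<in> {1..n}" using cyc_succ_in t(1) by blast
    have cne: "c (\<pi> t) \<noteq> c t" using cinj z t(1) pt(1) by blast
    show ?thesis
    proof (cases "c t < c (\<pi> t)")
      case True
      have "Suc (c t) \<noteq> n" using True clt[OF z] by simp
      then have "cyc_interval n (cyc_succ n t) (\<pi> t) \<subseteq> U (Suc (c t))"
      proof (intro subsetI)
        fix u assume "u \<in> cyc_interval n (cyc_succ n t) (\<pi> t)"
        then show "u \<in> U (Suc (c t))"
          using True interval[OF succE z, of u] csucc[OF t(1)] \<open>Suc (c t) \<noteq> n\<close>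
          by (auto simp: U_def)
      qed
      then have "fv.span (w ` cyc_interval n (cyc_succ n t) (\<pi> t)) \<subseteq> fv.span (w ` U (Suc (c t)))"
        by (intro fv.span_mono image_mono)
      then show ?thesis
        using pt(2) drop_at_iff_span[OF A ne t(1) z pt(1)[symmetric]] unfolding w_def by blast
    next
      case False
      \<comment> \<open>By \<open>no\<close>, the wrapped list meets \<open>s\<close> before
        \<open>\<pi> t\<close>, so there is no drop at \<open>s\<close> yet.\<close>
      then have lt: "c s < c (\<pi> t)" "c (\<pi> t) < c t" using no[OF t] cne by auto
      then have "s \<noteq> t" by auto
      have "cyc_pos n t s < cyc_pos n t (\<pi> t)"
        using lt cyc_pos_rebase[OF x t(1) sE] cyc_pos_rebase[OF x t(1) z] clt[OF t(1)]
        by (simp flip: c_def)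
      then have "\<not> drop_at n (column_bases A) t s"
        using first[of s] sE \<open>s \<noteq> t\<close> by blast
      then have "w t \<notin> fv.span (w ` cyc_interval n (cyc_succ n t) s)"
        using drop_at_iff_span[OF A ne t(1) sE] \<open>s \<noteq> t\<close> by (simp add: w_def)
      moreover have "cyc_interval n (cyc_succ n t) s = U (Suc (c t)) \<union> Q"
      proof (rule Set.set_eqI)
        fix u
        show "u \<in> cyc_interval n (cyc_succ n t) s \<longleftrightarrow> u \<in> U (Suc (c t)) \<union> Q"
          using interval[OF succE sE, of u] csucc[OF t(1)] lt clt[of u]
          by (auto simp: U_def Q_def split: if_splits)
      qed
      ultimately show ?thesis using lt by simp
    qed
  qed
  \<comment> \<open>The induction runs downwards from \<open>Suc (c y)\<close>, where the tail is
    \<open>I\<close> itself.\<close>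
  have inter: "v \<in> fv.span (w ` I)"
    if "c s < k" "k \<le> Suc (c y)" "v \<in> fv.span (w ` U k)" "v \<in> fv.span (w ` (I \<union> Q))" for k v
    using that(2,1,3,4)
  proof (induction k arbitrary: v rule: inc_induct)
    case base
    then show ?case by (simp add: I_eq)
  next
    case (step k)
    obtain t where t: "t \<in> {1..n}" "c t = k"
      using cyc_pos_surj[OF x, of k] step.hyps clt[OF y] unfolding c_def
      by (metis less_Suc_eq_le order_le_less_trans)
    have Uk: "U k = insert t (U (Suc k))"
    proof (rule Set.set_eqI)
      fix u
      have "u = t" if "u \<in> {1..n}" "c u = k" using cinj[OF that(1) t(1)] that(2) t(2) by simp
      moreover have "k \<le> c u \<longleftrightarrow> c u = k \<or> Suc k \<le> c u" by auto
      ultimately show "u \<in> U k \<longleftrightarrow> u \<in> insert t (U (Suc k))"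
        using t by (auto simp: U_def)
    qed
    have v: "v \<in> fv.span (insert (w t) (w ` U (Suc k)))" using step.prems(2) Uk by simp
    have "v \<in> fv.span (w ` U (Suc k))"
    proof (cases "w t \<in> fv.span (w ` U (Suc k))")
      case True
      then show ?thesis using v fv.span_redundant by blast
    next
      case False
      then have out: "w t \<notin> fv.span (w ` (U (Suc k) \<union> Q))"
        using first_drop[of t] t step.hyps step.prems(1) by auto
      obtain a where a: "v - (\<lambda>k. a * w t k) \<in> fv.span (w ` U (Suc k))"
        using v unfolding fv.span_breakdown_eq by blast
      \<comment> \<open>A nonzero coefficient would put \<open>w t\<close> into the span that
        \<open>first_drop\<close> excludes.\<close>
      have "a = 0"
      proof (rule ccontr)
        assume "a \<noteq> 0"
        have "I \<subseteq> U (Suc k)" using step.hyps by (auto simp: I_eq U_def)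
        then have "w ` (I \<union> Q) \<subseteq> w ` (U (Suc k) \<union> Q)" "w ` U (Suc k) \<subseteq> w ` (U (Suc k) \<union> Q)"
          by auto
        from this[THEN fv.span_mono] have "v \<in> fv.span (w ` (U (Suc k) \<union> Q))"
          "v - (\<lambda>k. a * w t k) \<in> fv.span (w ` (U (Suc k) \<union> Q))"
          using step.prems(3) a by blast+
        then have "v - (v - (\<lambda>k. a * w t k)) \<in> fv.span (w ` (U (Suc k) \<union> Q))"
          by (rule fv.span_diff)
        moreover have "v - (v - (\<lambda>k. a * w t k)) = (\<lambda>k. a * w t k)" by auto
        ultimately have "(\<lambda>k. inverse a * (a * w t k)) \<in> fv.span (w ` (U (Suc k) \<union> Q))"
          using fv.span_scale by metis
        moreover have "(\<lambda>k. inverse a * (a * w t k)) = w t" using \<open>a \<noteq> 0\<close> by auto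
        ultimately show False using out by simp
      qed
      then have "v - (\<lambda>k. a * w t k) = v" by auto
      then show ?thesis using a by (simp only:)
    qed
    then show ?case using step by simp
  qed
  \<comment> \<open>For \<open>t = s\<close> the second alternative of \<open>first_drop\<close> is
    impossible, as it asks for \<open>c s < c t\<close>.\<close>
  have "w s \<in> fv.span (w ` U (Suc (c s)))"
    using first_drop[OF sE _ cs] by simp
  moreover have "w s \<in> fv.span (w ` (I \<union> Q))"
    using sE by (intro fv.span_base imageI) (simp add: Q_def)
  ultimately have "w s \<in> fv.span (w ` I)"
    using inter[of "Suc (c s)"] cs by simp
  then show False using flat by (simp add: w_def I_def)
qed

text \<open>Since the first drop for \<open>y\<close> is at \<open>x\<close>, column
  \<open>y\<close> is spanned by the complement with \<open>x\<close> but not by the complement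
  alone. A further \<open>s\<close> in the latter span would give crossing pairs.\<close>

lemma arrow_complement_flat:
  assumes pos: "positroid n M" and loopless: "loopless {1..n} M"
    and dp: "decorated_permutation n M \<mu>"
    and y: "y \<in> {1..n}" and x: "x = \<mu> y" and s: "s \<in> cyc_interval n x y"
  shows "rk M (insert s ({1..n} - cyc_interval n x y)) \<noteq> rk M ({1..n} - cyc_interval n x y)"
proof -
  obtain d A where A: "A \<in> carrier_mat d n" and M: "M = column_bases A"
    and nonneg: "\<And>S. S \<in> max_column_sets A \<Longrightarrow> 0 \<le> max_minor A S"
    using pos unfolding positroid_def by blast
  have ne: "column_bases A \<noteq> {}"
    using pos M by (simp add: positroid_def matroid_def)
  have dim: "dim_col A = n" using A by simp
  have xE: "x \<in> {1..n}"
    using dp y permutes_in_image[of \<mu> "{1..n}" y] by (simp add: decorated_permutation_def x)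
  have "x \<noteq> y" and drop: "drop_at n (column_bases A) y x"
    and first: "\<And>j. j \<in> {1..n} - {y} \<Longrightarrow> cyc_pos n y j < cyc_pos n y x \<Longrightarrow>
      \<not> drop_at n (column_bases A) y j"
    using dp y by (auto simp: decorated_permutation_def M x)
  from \<open>x \<noteq> y\<close> have xy: "y \<noteq> x" by simp
  define w where "w = colv A"
  define c where "c = cyc_pos n x"
  define I where "I = {1..n} - cyc_interval n x y"
  have interval: "u \<in> cyc_interval n a b \<longleftrightarrow> u \<in> {1..n} \<and>
      (if c a \<le> c b then c a \<le> c u \<and> c u \<le> c b else c a \<le> c u \<or> c u \<le> c b)"
    if "a \<in> {1..n}" "b \<in> {1..n}" for a b u
    using cyc_interval_rebase[OF xE that] unfolding c_def .
  have cx: "c x = 0" using cyc_pos_self[OF xE] by (simp add: c_def)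
  have clt: "c u < n" if "u \<in> {1..n}" for u using cyc_pos_less[OF that] by (simp add: c_def)
  have cinj: "u = v" if "u \<in> {1..n}" "v \<in> {1..n}" "c u = c v" for u v
    using cyc_pos_inj[OF xE that(1,2)] that(3) by (simp add: c_def)
  have csucc: "c (cyc_succ n y) = (if Suc (c y) = n then 0 else Suc (c y))"
    using cyc_pos_succ[OF xE y] by (simp add: c_def)
  have succE: "cyc_succ n y \<in> {1..n}" using cyc_succ_in y by blast
  have sE: "s \<in> {1..n}" and cs: "c s \<le> c y"
    using s interval[OF xE y, of s] cx by auto
  have I_iff: "u \<in> I \<longleftrightarrow> u \<in> {1..n} \<and> c y < c u" for u
    using interval[OF xE y, of u] cx by (auto simp: I_def)
  have IE: "I \<subseteq> {1..n}" by (auto simp: I_def)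
  have "cyc_interval n (cyc_succ n y) x = insert x I"
  proof (rule Set.set_eqI)
    fix u
    have "u \<in> {1..n} \<Longrightarrow> c u = 0 \<Longrightarrow> u = x" using cinj[OF _ xE] cx by metis
    then show "u \<in> cyc_interval n (cyc_succ n y) x \<longleftrightarrow> u \<in> insert x I"
      using interval[OF succE xE, of u] csucc cx xE I_iff[of u] clt[of u]
      by (auto split: if_splits)
  qed
  then have y_in: "w y \<in> fv.span (w ` insert x I)"
    using drop drop_at_iff_span[OF A ne y xE xy] by (simp add: w_def)
  have nz: "w u \<noteq> 0" if "u \<in> {1..n}" for u
    using loopless_colv_nonzero[OF _ that] loopless by (simp add: M w_def)
  have y_out: "w y \<notin> fv.span (w ` I)"
  \<comment> \<open>If \<open>x\<close> directly follows \<open>y\<close>, the complement is empty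
    and looplessness decides. Otherwise there is no drop yet at the predecessor \<open>z\<close> of
    \<open>x\<close>, at position \<open>n - 1\<close>.\<close>
  proof (cases "Suc (c y) = n")
    case True
    then have "I = {}" using I_iff clt by fastforce
    then show ?thesis using nz[OF y] by simp
  next
    case False
    then have lt: "Suc (c y) < n" using clt[OF y] by simp
    then have "n - 1 < n" by simp
    then obtain z where z: "z \<in> {1..n}" "c z = n - 1"
      using cyc_pos_surj[OF xE, of "n - 1"] unfolding c_def by blast
    have zy: "z \<noteq> y" using z(2) lt by auto
    have "cyc_pos n y z < cyc_pos n y x"
      using z lt cx cyc_pos_rebase[OF xE y z(1)] cyc_pos_rebase[OF xE y xE]
        cinj[OF y xE] xy by (auto simp flip: c_def)
    then have "\<not> drop_at n (column_bases A) y z" using first z zy by blast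
    then have "w y \<notin> fv.span (w ` cyc_interval n (cyc_succ n y) z)"
      using drop_at_iff_span[OF A ne y z(1) zy[symmetric]] by (simp add: w_def)
    moreover have "cyc_interval n (cyc_succ n y) z = I"
    proof (rule Set.set_eqI)
      fix u
      show "u \<in> cyc_interval n (cyc_succ n y) z \<longleftrightarrow> u \<in> I"
        using interval[OF succE z(1), of u] csucc z lt I_iff[of u] clt[of u] by auto
    qed
    ultimately show ?thesis by simp
  qed
  have "w s \<notin> fv.span (w ` I)"
  proof
    assume s_in: "w s \<in> fv.span (w ` I)"
    have "s \<noteq> x"
      using s_in y_in y_out fv.span_redundant[of "w x" "w ` I"] by auto
    have "s \<noteq> y" using s_in y_out by blast
    have pos_s: "0 < c s" "c s < c y"
      using \<open>s \<noteq> x\<close> \<open>s \<noteq> y\<close> cinj[OF sE xE] cinj[OF sE y] cx cs by (auto simp: order_le_less)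
    \<comment> \<open>From \<open>x\<close> the order is \<open>x\<close>, \<open>s\<close>,
      \<open>y\<close>, \<open>i\<close>. Crossing is invariant under rotation, so it also holds in
      the usual order, which governs the signs of minors.\<close>
    have cross: "((i < x) \<noteq> (s < x)) \<noteq> ((i < y) \<noteq> (s < y))" if "i \<in> I" for i
    proof -
      have "i \<in> {1..n}" "c y < c i" using that I_iff by auto
      then show ?thesis
        using pos_s xE y sE by (auto simp: c_def cyc_pos_eq split: if_splits)
    qed
    have "s \<notin> I" using I_iff cs by auto
    show False
      by (rule nonneg_minors_no_crossing[of A I x y s])
        (use nonneg ne dim IE xE y sE \<open>s \<notin> I\<close> \<open>s \<noteq> x\<close> \<open>s \<noteq> y\<close> cross y_in y_out s_in nz[OF sE] xy
          in \<open>simp_all add: w_def\<close>)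
  qed
  then show ?thesis
    using rk_insert_eq_iff[OF ne, of I s] IE sE dim by (simp add: M w_def I_def)
qed

section \<open>Transfer between the two concordant positroids\<close>

theorem proposition6p2:
  fixes n :: nat and M\<^sub>\<pi> M\<^sub>\<mu> :: "nat set set" and \<pi> \<mu> :: "nat \<Rightarrow> nat"
  assumes "positroid n M\<^sub>\<pi>" and "positroid n M\<^sub>\<mu>"
    and "loopless {1..n} M\<^sub>\<pi>" and "coloopless {1..n} M\<^sub>\<pi>"
    and "loopless {1..n} M\<^sub>\<mu>" and "coloopless {1..n} M\<^sub>\<mu>"
    and "decorated_permutation n M\<^sub>\<pi> \<pi>" and "decorated_permutation n M\<^sub>\<mu> \<mu>"
    and "rk M\<^sub>\<mu> {1..n} < rk M\<^sub>\<pi> {1..n}"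
    and "concordant n M\<^sub>\<mu> M\<^sub>\<pi>"
  shows "\<forall>I \<in> ccw_arrows n \<mu>. covered_by_ccw_arrows n \<pi> I"
proof
  fix I assume "I \<in> ccw_arrows n \<mu>"
  then obtain x where x: "x \<in> {1..n}" "I = cyc_interval n x (inv_into {1..n} \<mu> x)"
    by (auto simp: ccw_arrows_def)
  define y where "y = inv_into {1..n} \<mu> x"
  have "\<mu> permutes {1..n}" using assms(8) by (simp add: decorated_permutation_def)
  then have "\<mu> ` {1..n} = {1..n}" by (rule permutes_image)
  then have y: "y \<in> {1..n}" "x = \<mu> y"
    using x(1) inv_into_into[of x \<mu> "{1..n}"] f_inv_into_f[of x \<mu> "{1..n}"]
    unfolding y_def by auto
  define r where "r = rk M\<^sub>\<mu> {1..n}"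
  define d where "d = rk M\<^sub>\<pi> {1..n}"
  obtain A where A: "A \<in> carrier_mat d n" "column_bases A = M\<^sub>\<pi>"
    "column_bases (first_rows r A) = M\<^sub>\<mu>" and rd: "r < d"
    using assms(10) unfolding concordant_def Let_def r_def d_def by blast
  have ne: "M\<^sub>\<pi> \<noteq> {}" "M\<^sub>\<mu> \<noteq> {}" using assms(1,2) by (simp_all add: positroid_def matroid_def)
  have dim: "dim_col (first_rows r A) = n"
    using A(1) by (simp add: first_rows_def submatrix_def)
  show "covered_by_ccw_arrows n \<pi> I"
    unfolding covered_by_ccw_arrows_def
  proof
    fix s assume "s \<in> I"
    then have s: "s \<in> cyc_interval n x y" "s \<in> {1..n}"
      using x(2) by (auto simp: y_def cyc_interval_def)
    define T where "T = {1..n} - cyc_interval n x y"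
    have "colv (first_rows r A) s \<notin> fv.span (colv (first_rows r A) ` T)"
      using arrow_complement_flat[OF assms(2,5,8) y s(1)] s(2) dim ne(2) A(3)
        rk_insert_eq_iff[of "first_rows r A" T s] by (auto simp: T_def)
    \<comment> \<open>The complement is closed for the first \<open>r\<close> rows, and restoring
      the deleted rows cannot create a dependency.\<close>
    then have "colv A s \<notin> fv.span (colv A ` T)"
      using span_colv_first_rows[OF A(1) less_imp_le[OF rd], of T s] s(2) by (auto simp: T_def)
    then show "\<exists>J \<in> ccw_arrows n \<pi>. s \<in> J \<and> J \<subseteq> I"
      using arrow_covering_flat_complement[OF A(1) _ _ x(1) y(1) s(1), of \<pi>] assms(7) ne(1) A(2) x(2)
      by (simp add: T_def y_def)
  qed
qed

end
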